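(* There is a function $\delta:\mathbb{N}\to\mathbb{R}$ with $\delta(n)\to 0$ as $n\to\infty$ such that for all sufficiently large $n$, all integers $a,b\ge 1$ with $a+b=n$, all $\varepsilon\in(0,1)$, and all integers $$t\ \ge\ \frac{2+\delta(n)}{\pi^2}\,n^3\log\frac{ab}{\varepsilon},$$ after $t$ steps of the lattice path Markov chain on paths in the $a\times b$ rectangle, the variation distance from stationarity is at most $\varepsilon$ (for every starting path), and the probability that the two extremal paths, run together under the sort/reverse-sort coupling, have coalesced is at least $1-\varepsilon$. (The function $\delta$ depends on $n$ alone.)
   Context: Lattice paths in the $a\times b$ rectangle are binary strings of length $n=a+b$ with exactly $a$ zeros (down moves) and $b$ ones (up moves). The lattice path Markov chain: at each step choose one of the $n-1$ adjacent pairs of positions uniformly at random and flip a fair coin; if heads sort the two letters in that pair (so that they read in increasing order), otherwise reverse-sort them (decreasing order). The stationary distribution is uniform. The sort/reverse-sort coupling applies the same random pair and the same coin to every path at each step. The two extremal paths are the topmost path $1^b0^a$ and the bottommost path $0^a1^b$; they have coalesced at time $t$ if the two coupled copies of the chain started from them are equal at time $t$. Variation distance is total variation distance $\frac12\|\cdot\|_1$ between the law of the state at time $t$ and the uniform distribution. $\log$ is the natural logarithm. *)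

theory Defs
  imports "HOL-Probability.Probability"
begin

text \<open>
  Letters are Booleans: \<^term>\<open>False\<close> is the letter 0 (down move) and \<^term>\<open>True\<close> is the
  letter 1 (up move), so the order on letters is the library order on \<^typ>\<open>bool\<close>.
\<close>

definition lattice_paths :: "nat \<Rightarrow> nat \<Rightarrow> bool list set" where
  "lattice_paths a b =
     {w. length w = a + b \<and> count_list w False = a \<and> count_list w True = b}"

definition top_path :: "nat \<Rightarrow> nat \<Rightarrow> bool list" where
  "top_path a b = replicate b True @ replicate a False"

definition bottom_path :: "nat \<Rightarrow> nat \<Rightarrow> bool list" where
  "bottom_path a b = replicate a False @ replicate b True"

text \<open>
  A move \<open>(i, c)\<close> is an adjacent pair of (0-based) positions \<open>i\<close>, \<open>i + 1\<close> together with the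
  outcome of the coin: heads (\<open>c = True\<close>) sorts the two letters, tails reverse-sorts them.
\<close>

fun apply_move :: "nat \<times> bool \<Rightarrow> bool list \<Rightarrow> bool list" where
  "apply_move (i, c) w =
     (let lo = min (w ! i) (w ! Suc i); hi = max (w ! i) (w ! Suc i)
      in if c then w[i := lo, Suc i := hi] else w[i := hi, Suc i := lo])"

definition random_move :: "nat \<Rightarrow> (nat \<times> bool) pmf" where
  "random_move n = pair_pmf (pmf_of_set {..<n - 1}) (bernoulli_pmf (1 / 2))"

definition path_kernel :: "nat \<Rightarrow> bool list \<Rightarrow> bool list pmf" where
  "path_kernel n w = map_pmf (\<lambda>m. apply_move m w) (random_move n)"

primrec path_law :: "nat \<Rightarrow> bool list \<Rightarrow> nat \<Rightarrow> bool list pmf" where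
  "path_law n w 0 = return_pmf w"
| "path_law n w (Suc t) = bind_pmf (path_law n w t) (path_kernel n)"

definition tv_dist :: "'a pmf \<Rightarrow> 'a pmf \<Rightarrow> real" where
  "tv_dist p q = (1 / 2) * (\<Sum>\<^sub>\<infinity>x. \<bar>pmf p x - pmf q x\<bar>)"

text \<open>
  In the sort/reverse-sort coupling a single list of \<open>t\<close> independent random moves drives the
  copies from all starting paths; its first element is the first move made.
\<close>

definition run_moves :: "(nat \<times> bool) list \<Rightarrow> bool list \<Rightarrow> bool list" where
  "run_moves ms w = fold apply_move ms w"

definition coalescence_prob :: "nat \<Rightarrow> nat \<Rightarrow> nat \<Rightarrow> real" where
  "coalescence_prob a b t =
     measure_pmf.prob (replicate_pmf t (random_move (a + b)))
       {ms. run_moves ms (top_path a b) = run_moves ms (bottom_path a b)}"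

end

theory Submission
  imports Defs "HOL-Real_Asymp.Real_Asymp"
begin

text \<open>
  Encode a path by its partial sums. Sorting and reverse-sorting a pair with probability 1/2 each
  replaces, in expectation, the height at that position by the mean of its two neighbours, so the
  height difference of two coupled paths evolves as a heat flow with zero boundary values. Weighting
  this nonnegative difference by \<open>cos (\<beta> (k/n - 1/2))\<close> with \<open>\<beta> < \<pi>\<close> gives a gap that contracts by
  \<open>1 - (1 - cos (\<beta>/n)) / (n - 1)\<close> per step, starts at no more than \<open>ab\<close>, and is at least
  \<open>cos (\<beta>/2)\<close> until coalescence; Markov's inequality then bounds the probability of not having
  coalesced. Letting \<open>\<beta> = \<pi> - 1 / ln n\<close> makes the rate asymptotically optimal while
  \<open>- ln (cos (\<beta>/2))\<close>, of order \<open>ln (ln n)\<close>, stays negligible against \<open>ln (ab) \<ge> ln (n - 1)\<close>. The moves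
  are monotone, so coalescence of the extremal paths forces that of all paths, and coupling with
  a uniform start bounds the variation distance.
\<close>

section \<open>Heights of a path (partial sums) and the effect of one move on them\<close>

definition ones :: "bool list \<Rightarrow> nat \<Rightarrow> nat" where
  "ones w k = count_list (take k w) True"

definition transpose_at :: "nat \<Rightarrow> 'a list \<Rightarrow> 'a list" where
  "transpose_at i w = w[i := w ! Suc i, Suc i := w ! i]"

lemma length_transpose_at [simp]: "length (transpose_at i w) = length w"
  by (simp add: transpose_at_def)

lemma length_apply_move [simp]: "length (apply_move m w) = length w"
  by (cases m) (simp add: Let_def)

lemma length_run_moves [simp]: "length (run_moves ms w) = length w"
  unfolding run_moves_def by (induction ms arbitrary: w) auto

lemma run_moves_Cons: "run_moves (m # ms) w = run_moves ms (apply_move m w)"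
  by (simp add: run_moves_def)

lemma transpose_at_transpose_at:
  "Suc i < length w \<Longrightarrow> transpose_at i (transpose_at i w) = w"
  unfolding transpose_at_def by (intro nth_equalityI) (auto simp: nth_list_update)

lemma mset_transpose_at:
  "Suc i < length w \<Longrightarrow> mset (transpose_at i w) = mset w"
  unfolding transpose_at_def by (rule mset_swap) auto

lemma count_list_transpose_at:
  "Suc i < length w \<Longrightarrow> count_list (transpose_at i w) x = count_list w x"
  by (metis count_mset mset_transpose_at)

text \<open>A move either keeps or swaps the pair. Ties do no harm: on equal letters the
  transposition is itself the identity.\<close>

lemma apply_move_eq:
  assumes "Suc i < length w"
  shows "apply_move (i, c) w = (if c = (w ! i \<le> w ! Suc i) then w else transpose_at i w)"
proof -
  have id: "w[i := w ! i, Suc i := w ! Suc i] = w"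
    by simp
  show ?thesis
    unfolding apply_move.simps Let_def transpose_at_def min_def max_def
    by (cases c; cases "w ! i \<le> w ! Suc i") (simp_all only: id if_True if_False refl simp_thms)
qed

lemma ones_0 [simp]: "ones w 0 = 0"
  by (simp add: ones_def)

lemma ones_Suc: "k < length w \<Longrightarrow> ones w (Suc k) = ones w k + of_bool (w ! k)"
  by (simp add: ones_def take_Suc_conv_app_nth)

lemma ones_transpose_at:
  assumes "Suc i < length w" "k \<noteq> Suc i"
  shows "ones (transpose_at i w) k = ones w k"
proof (cases "k \<le> i")
  case True
  then show ?thesis by (simp add: ones_def transpose_at_def)
next
  case False
  with assms have k: "Suc i < k" by simp
  then have "take k (transpose_at i w) = transpose_at i (take k w)"
    by (simp add: transpose_at_def take_update_swap)
  then show ?thesis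
    using assms k by (simp add: ones_def count_list_transpose_at)
qed

lemma ones_apply_move_other:
  assumes "Suc i < length w" "k \<noteq> Suc i"
  shows "ones (apply_move (i, c) w) k = ones w k"
  using ones_transpose_at[OF assms] apply_move_eq[OF assms(1)] by auto

text \<open>Sorting takes the lowest middle height compatible with the two neighbours,
  reverse-sorting the highest. Neither depends on the old middle height, and both are monotone in
  the neighbours. The truncated subtraction is harmless because of the outer
  \<open>max\<close>.\<close>

lemma ones_apply_move_same:
  assumes "Suc i < length w"
  shows "ones (apply_move (i, c) w) (Suc i) =
    (if c then max (ones w i) (ones w (Suc (Suc i)) - 1)
     else min (Suc (ones w i)) (ones w (Suc (Suc i))))"
proof -
  have "ones (apply_move (i, c) w) (Suc i) = ones w i + of_bool (apply_move (i, c) w ! i)"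
    using assms by (subst ones_Suc) (auto simp: ones_apply_move_other simp del: apply_move.simps)
  moreover have "apply_move (i, c) w ! i = (if c then w ! i \<and> w ! Suc i else w ! i \<or> w ! Suc i)"
    using assms by (auto simp: Let_def min_def max_def)
  moreover have "ones w (Suc (Suc i)) = ones w i + of_bool (w ! i) + of_bool (w ! Suc i)"
    using assms by (simp add: ones_Suc)
  ultimately show ?thesis by (auto simp del: apply_move.simps)
qed

text \<open>The letter placed at \<open>i\<close> is the conjunction or the disjunction of the two
  old letters, and these two values add up to the sum of the letters. This is the discrete heat
  equation for heights.\<close>

lemma ones_apply_move_average:
  assumes "Suc i < length w"
  shows "real (ones (apply_move (i, True) w) (Suc i)) + real (ones (apply_move (i, False) w) (Suc i))
       = real (ones w i) + real (ones w (Suc (Suc i)))"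
proof -
  have "ones w (Suc (Suc i)) = ones w i + of_bool (w ! i) + of_bool (w ! Suc i)"
    using assms by (simp add: ones_Suc)
  then show ?thesis
    using assms by (auto simp: ones_apply_move_same max_def min_def simp del: apply_move.simps)
qed

lemma ones_inject:
  assumes "length w = length v" "\<And>k. ones w k = ones v k"
  shows "w = v"
proof (rule nth_equalityI)
  fix i assume "i < length w"
  then show "w ! i = v ! i"
    using assms ones_Suc[of i w] ones_Suc[of i v] by (auto simp: of_bool_eq_iff)
qed (fact assms(1))

section \<open>The pointwise order of heights and monotonicity of the moves\<close>

definition path_le :: "bool list \<Rightarrow> bool list \<Rightarrow> bool" where
  "path_le v w \<longleftrightarrow> length v = length w \<and> (\<forall>k. ones v k \<le> ones w k)"

lemma path_le_antisym: "path_le v w \<Longrightarrow> path_le w v \<Longrightarrow> v = w"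
  unfolding path_le_def by (intro ones_inject) (auto intro: antisym)

text \<open>Only the middle height changes, and its new value is the same monotone function of the
  neighbouring heights for both paths, since they share the position and the coin.\<close>

lemma path_le_apply_move:
  assumes "path_le v w" "Suc i < length w"
  shows "path_le (apply_move (i, c) v) (apply_move (i, c) w)"
  unfolding path_le_def
proof (intro conjI allI)
  show "length (apply_move (i, c) v) = length (apply_move (i, c) w)"
    using assms by (simp add: path_le_def del: apply_move.simps)
  fix k
  have le: "ones v j \<le> ones w j" and len: "length v = length w" for j
    using assms by (auto simp: path_le_def)
  show "ones (apply_move (i, c) v) k \<le> ones (apply_move (i, c) w) k"
  proof (cases "k = Suc i")
    case True
    show ?thesis
      using le[of i] le[of "Suc (Suc i)"] assms len
      by (auto simp: True ones_apply_move_same max_def min_def simp del: apply_move.simps)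
  next
    case False
    then show ?thesis
      using le assms len by (simp add: ones_apply_move_other del: apply_move.simps)
  qed
qed

lemma path_le_run_moves:
  assumes "path_le v w" "\<And>m. m \<in> set ms \<Longrightarrow> Suc (fst m) < length w"
  shows "path_le (run_moves ms v) (run_moves ms w)"
  using assms
proof (induction ms arbitrary: v w)
  case (Cons m ms)
  then have "path_le (apply_move m v) (apply_move m w)"
    using path_le_apply_move[of v w "fst m" "snd m"] by simp
  with Cons show ?case by (simp add: run_moves_Cons)
qed (simp add: run_moves_def)

section \<open>Lattice paths, the extremal pair and the area between them\<close>

lemma lattice_paths_altdef:
  "lattice_paths a b = {w. length w = a + b \<and> count_list w True = b}"
proof -
  have "length w = count_list w False + count_list w True" for w
    by (induction w) auto
  then show ?thesis by (auto simp: lattice_paths_def)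
qed

lemma ones_lattice_path: "w \<in> lattice_paths a b \<Longrightarrow> ones w (a + b) = b"
  by (simp add: lattice_paths_altdef ones_def)

lemma count_list_replicate: "count_list (replicate k x) y = (if x = y then k else 0)"
  by (induction k) auto

lemma extremal_lattice_paths:
  "top_path a b \<in> lattice_paths a b" "bottom_path a b \<in> lattice_paths a b"
  by (auto simp: lattice_paths_altdef top_path_def bottom_path_def count_list_replicate)

lemma finite_lattice_paths: "finite (lattice_paths a b)"
  by (rule finite_subset[OF _ finite_lists_length_eq[of "UNIV :: bool set" "a + b"]])
     (auto simp: lattice_paths_def)

text \<open>The swap is an involution preserving letter counts. Invariance of the uniform law rests
  on this.\<close>

lemma transpose_at_lattice_paths:
  assumes "Suc i < a + b"
  shows "bij_betw (transpose_at i) (lattice_paths a b) (lattice_paths a b)"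
proof (rule bij_betwI[where g = "transpose_at i"])
  show "transpose_at i \<in> lattice_paths a b \<rightarrow> lattice_paths a b"
    using assms by (auto simp: lattice_paths_def count_list_transpose_at)
  then show "transpose_at i \<in> lattice_paths a b \<rightarrow> lattice_paths a b" .
qed (use assms in \<open>auto simp: lattice_paths_def transpose_at_transpose_at\<close>)

lemma ones_top_path: "ones (top_path a b) k = min k b"
  by (simp add: ones_def top_path_def count_list_replicate)

lemma ones_bottom_path: "ones (bottom_path a b) k = min (k - a) b"
  by (simp add: ones_def bottom_path_def count_list_replicate)

text \<open>A prefix holds at most \<open>b\<close> ones and at most \<open>a\<close> zeros; the
  second bound leaves at least \<open>k - a\<close> ones when \<open>k\<close> does not exceed the
  length.\<close>

lemma path_le_extremal:
  assumes "w \<in> lattice_paths a b"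
  shows "path_le w (top_path a b)" "path_le (bottom_path a b) w"
proof -
  have tot: "length u = count_list u False + count_list u True" for u
    by (induction u) auto
  have split: "count_list w x = count_list (take k w) x + count_list (drop k w) x" for k x
    by (metis append_take_drop_id count_list_append)
  have w: "length w = a + b" "count_list w False = a" "count_list w True = b"
    using assms by (auto simp: lattice_paths_def)
  have le: "count_list (take k w) x \<le> count_list w x" for k x
    using split[of x k] by linarith
  have "ones w k \<le> min k b" for k
    using le[of k True] tot[of "take k w"] unfolding ones_def w length_take by linarith
  then show "path_le w (top_path a b)"
    using w by (simp add: path_le_def ones_top_path) (simp add: top_path_def)
  have "min (k - a) b \<le> ones w k" for k
    using le[of k False] tot[of "take k w"] unfolding ones_def w length_take by linarith
  then show "path_le (bottom_path a b) w"
    using w by (simp add: path_le_def ones_bottom_path) (simp add: bottom_path_def)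
qed

text \<open>The area between the paths is that of the rectangle. Both sums contain the same
  triangular number; the top path adds a plateau of \<open>a\<close> terms equal to
  \<open>b\<close>, the bottom path only \<open>a\<close> zeros.\<close>

lemma sum_ones_extremal:
  "(\<Sum>k\<le>a + b. ones (top_path a b) k) = (\<Sum>k\<le>a + b. ones (bottom_path a b) k) + a * b"
proof -
  have "(\<Sum>k\<le>b + a. min k b) = (\<Sum>k\<le>b. k) + a * b"
    by (induction a) auto
  moreover have "(\<Sum>k\<le>a + b. k - a) = (\<Sum>k\<le>b. k)"
    by (induction b) auto
  moreover have "(\<Sum>k\<le>a + b. min (k - a) b) = (\<Sum>k\<le>a + b. k - a)"
    by (intro sum.cong) auto
  ultimately show ?thesis
    by (simp add: ones_top_path ones_bottom_path add.commute)
qed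

section \<open>Contraction of the cosine-weighted gap in one step\<close>

lemma cosine_weighted_laplacian:
  fixes d :: "nat \<Rightarrow> real" and \<beta> :: real and m :: nat
  defines "u \<equiv> \<lambda>k. cos (\<beta> * (real k / real (Suc m) - 1 / 2))"
  assumes d: "d 0 = 0" "d (Suc m) = 0" "\<And>k. 0 \<le> d k"
    and u: "\<And>k. k \<le> Suc m \<Longrightarrow> 0 \<le> u k"
  shows "(\<Sum>i<m. u (Suc i) * ((d i + d (Suc (Suc i))) / 2 - d (Suc i)))
    \<le> - (1 - cos (\<beta> / real (Suc m))) * (\<Sum>i<m. u (Suc i) * d (Suc i))"
proof -
  \<comment> \<open>The cosine is an eigenfunction of the neighbour sum, by the addition
    formulas.\<close>
  have rec: "u i + u (Suc (Suc i)) = 2 * cos (\<beta> / real (Suc m)) * u (Suc i)" for i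
  proof -
    define x y where "x = \<beta> * (real (Suc i) / real (Suc m) - 1 / 2)" and "y = \<beta> / real (Suc m)"
    have "\<beta> * (real i / real (Suc m) - 1 / 2) = x - y"
         "\<beta> * (real (Suc (Suc i)) / real (Suc m) - 1 / 2) = x + y"
      unfolding x_def y_def
      by (simp_all add: add_divide_distrib diff_divide_distrib distrib_left right_diff_distrib)
    then have "u i + u (Suc (Suc i)) = cos (x - y) + cos (x + y)"
      unfolding u_def by presburger
    also have "\<dots> = 2 * cos y * cos x" by (simp add: cos_add cos_diff)
    finally show ?thesis unfolding x_def y_def u_def .
  qed
  \<comment> \<open>Summation by parts: both shifts move from \<open>d\<close> to \<open>u\<close>.
    The weight need not vanish at the ends, so each shift drops a nonnegative boundary term and only
    an inequality remains.\<close>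
  have "(\<Sum>i<Suc m. u (Suc i) * d i) = u 1 * d 0 + (\<Sum>i<m. u (Suc (Suc i)) * d (Suc i))"
    by (subst sum.lessThan_Suc_shift) simp
  then have "(\<Sum>i<m. u (Suc i) * d i) \<le> (\<Sum>i<m. u (Suc (Suc i)) * d (Suc i))"
    using d mult_nonneg_nonneg[OF u[of "Suc m"] d(3)[of m]] by simp
  moreover have "(\<Sum>i<Suc m. u i * d (Suc i)) = u 0 * d 1 + (\<Sum>i<m. u (Suc i) * d (Suc (Suc i)))"
    by (subst sum.lessThan_Suc_shift) simp
  then have "(\<Sum>i<m. u (Suc i) * d (Suc (Suc i))) \<le> (\<Sum>i<m. u i * d (Suc i))"
    using d mult_nonneg_nonneg[OF u[of 0] d(3)[of 1]] by simp
  ultimately have "(\<Sum>i<m. u (Suc i) * d i + u (Suc i) * d (Suc (Suc i)))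
      \<le> (\<Sum>i<m. (u i + u (Suc (Suc i))) * d (Suc i))"
    by (simp add: sum.distrib algebra_simps)
  also have "\<dots> = 2 * cos (\<beta> / real (Suc m)) * (\<Sum>i<m. u (Suc i) * d (Suc i))"
    by (simp only: rec) (simp add: sum_distrib_left mult.assoc)
  finally have "(\<Sum>i<m. u (Suc i) * d i + u (Suc i) * d (Suc (Suc i)))
      \<le> 2 * cos (\<beta> / real (Suc m)) * (\<Sum>i<m. u (Suc i) * d (Suc i))" .
  moreover have "(\<Sum>i<m. u (Suc i) * ((d i + d (Suc (Suc i))) / 2 - d (Suc i)))
      = (\<Sum>i<m. u (Suc i) * d i + u (Suc i) * d (Suc (Suc i))) / 2 - (\<Sum>i<m. u (Suc i) * d (Suc i))"
    by (simp add: sum_divide_distrib sum_subtractf[symmetric] algebra_simps add_divide_distrib)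
  ultimately show ?thesis by (simp add: algebra_simps)
qed

text \<open>The index \<open>i\<close> matches the position of a move: \<open>(i, c)\<close> affects
  only the summand at the interior height \<open>Suc i\<close>. The argument \<open>v\<close> is
  meant to be the lower path.\<close>

definition gap :: "real \<Rightarrow> nat \<Rightarrow> bool list \<Rightarrow> bool list \<Rightarrow> real" where
  "gap \<beta> n v w = (\<Sum>i<n - 1. cos (\<beta> * (real (Suc i) / real n - 1 / 2))
                     * (real (ones w (Suc i)) - real (ones v (Suc i))))"

text \<open>The argument is at most \<open>\<beta> / 2\<close> in absolute value, and cosine
  decreases on the interval from 0 to \<open>pi\<close>.\<close>

lemma cos_weight_ge:
  assumes "0 \<le> \<beta>" "\<beta> \<le> pi" "k \<le> n" "0 < n"
  shows "cos (\<beta> / 2) \<le> cos (\<beta> * (real k / real n - 1 / 2))"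
proof -
  have "\<bar>real k / real n - 1 / 2\<bar> \<le> 1 / 2"
    using assms by (auto simp: abs_le_iff field_simps)
  then have "\<bar>\<beta> * (real k / real n - 1 / 2)\<bar> \<le> \<beta> * (1 / 2)"
    using assms by (simp only: abs_mult abs_of_nonneg mult_left_mono)
  then have "cos (\<beta> / 2) \<le> cos \<bar>\<beta> * (real k / real n - 1 / 2)\<bar>"
    using assms by (intro cos_monotone_0_pi_le) auto
  then show ?thesis by simp
qed

lemma gap_apply_move:
  assumes "Suc i < n" "length v = n" "length w = n"
  shows "gap \<beta> n (apply_move (i, c) v) (apply_move (i, c) w) = gap \<beta> n v w
    + cos (\<beta> * (real (Suc i) / real n - 1 / 2))
      * ((real (ones (apply_move (i, c) w) (Suc i)) - real (ones (apply_move (i, c) v) (Suc i)))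
         - (real (ones w (Suc i)) - real (ones v (Suc i))))"
proof -
  have i: "i \<in> {..<n - 1}" using assms by simp
  have "(\<Sum>k\<in>{..<n - 1} - {i}. cos (\<beta> * (real (Suc k) / real n - 1 / 2))
          * (real (ones (apply_move (i, c) w) (Suc k)) - real (ones (apply_move (i, c) v) (Suc k))))
      = (\<Sum>k\<in>{..<n - 1} - {i}. cos (\<beta> * (real (Suc k) / real n - 1 / 2))
          * (real (ones w (Suc k)) - real (ones v (Suc k))))"
    using assms by (intro sum.cong) (auto simp: ones_apply_move_other simp del: apply_move.simps)
  then show ?thesis
    unfolding gap_def sum.remove[OF finite_lessThan i]
    by (simp add: algebra_simps del: apply_move.simps)
qed

lemma set_random_move:
  assumes "2 \<le> n" "m \<in> set_pmf (random_move n)"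
  shows "Suc (fst m) < n"
proof -
  have "{..<n - 1} \<noteq> {}" using assms(1) by (simp add: lessThan_empty_iff)
  with assms show ?thesis by (auto simp: random_move_def)
qed

lemma expectation_random_move:
  fixes f :: "nat \<times> bool \<Rightarrow> real"
  assumes "2 \<le> n"
  shows "measure_pmf.expectation (random_move n) f =
    (\<Sum>i<n - 1. (f (i, True) + f (i, False)) / 2) / real (n - 1)"
proof -
  have ne: "{..<n - 1} \<noteq> {}" using assms by (simp add: lessThan_empty_iff)
  have "measure_pmf.expectation (random_move n) f
      = (\<Sum>m\<in>{..<n - 1} \<times> UNIV. pmf (random_move n) m *\<^sub>R f m)"
    using ne by (intro integral_measure_pmf) (auto simp: random_move_def)
  also have "\<dots> = (\<Sum>i<n - 1. \<Sum>c\<in>UNIV. pmf (random_move n) (i, c) * f (i, c))"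
    by (simp add: sum.cartesian_product)
  also have "\<dots> = (\<Sum>i<n - 1. (f (i, True) + f (i, False)) / 2 / real (n - 1))"
    using ne by (intro sum.cong) (auto simp: random_move_def pmf_pair UNIV_bool add_divide_distrib mult.commute)
  finally show ?thesis
    by (simp add: sum_divide_distrib)
qed

text \<open>Averaging over the coin replaces the height difference at \<open>Suc i\<close> by the
  mean of its neighbours; averaging over \<open>i\<close> then gives \<open>1 / (n - 1)\<close>
  times the weighted Laplacian of the difference, which vanishes at both ends.\<close>

lemma expectation_gap_random_move:
  assumes n: "2 \<le> n" and \<beta>: "0 \<le> \<beta>" "\<beta> \<le> pi"
    and le: "path_le v w" and len: "length w = n" and eq: "ones v n = ones w n"
  shows "measure_pmf.expectation (random_move n) (\<lambda>m. gap \<beta> n (apply_move m v) (apply_move m w))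
    \<le> (1 - (1 - cos (\<beta> / real n)) / (real n - 1)) * gap \<beta> n v w"
proof -
  obtain m where m: "n = Suc m" "0 < m" using n by (cases n) auto
  define d where "d k = real (ones w k) - real (ones v k)" for k
  define u where "u k = cos (\<beta> * (real k / real n - 1 / 2))" for k
  have lenv: "length v = n" using le len by (simp add: path_le_def)
  have "0 \<le> cos (\<beta> / 2)" using \<beta> by (intro cos_ge_zero) auto
  then have u: "0 \<le> u k" if "k \<le> n" for k
    using cos_weight_ge[OF \<beta> that] n unfolding u_def by linarith
  have d: "d 0 = 0" "d n = 0" "0 \<le> d k" for k
    using le eq by (auto simp: d_def path_le_def)
  have gap: "gap \<beta> n v w = (\<Sum>i<m. u (Suc i) * d (Suc i))"
    by (simp add: gap_def u_def d_def m)
  have avg: "(gap \<beta> n (apply_move (i, True) v) (apply_move (i, True) w)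
       + gap \<beta> n (apply_move (i, False) v) (apply_move (i, False) w)) / 2
     = gap \<beta> n v w + u (Suc i) * ((d i + d (Suc (Suc i))) / 2 - d (Suc i))" if "i < m" for i
  proof -
    have i: "Suc i < n" using that m by simp
    have "gap \<beta> n (apply_move (i, True) v) (apply_move (i, True) w)
       + gap \<beta> n (apply_move (i, False) v) (apply_move (i, False) w)
     = 2 * gap \<beta> n v w + u (Suc i) *
        ((real (ones (apply_move (i, True) w) (Suc i)) + real (ones (apply_move (i, False) w) (Suc i)))
       - (real (ones (apply_move (i, True) v) (Suc i)) + real (ones (apply_move (i, False) v) (Suc i)))
       - 2 * d (Suc i))"
      unfolding gap_apply_move[OF i lenv len] u_def[symmetric] d_def[symmetric]
      by (simp add: algebra_simps del: apply_move.simps)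
    also have "\<dots> = 2 * gap \<beta> n v w + u (Suc i) * (d i + d (Suc (Suc i)) - 2 * d (Suc i))"
      using i len lenv
      by (simp add: ones_apply_move_average d_def del: apply_move.simps)
    finally show ?thesis by (simp add: field_simps)
  qed
  have "measure_pmf.expectation (random_move n) (\<lambda>m. gap \<beta> n (apply_move m v) (apply_move m w))
      = (\<Sum>i<m. gap \<beta> n v w + u (Suc i) * ((d i + d (Suc (Suc i))) / 2 - d (Suc i))) / real m"
    unfolding expectation_random_move[OF n] by (simp only: m diff_Suc_1) (simp add: avg[unfolded m] del: apply_move.simps)
  also have "\<dots> = gap \<beta> n v w
      + (\<Sum>i<m. u (Suc i) * ((d i + d (Suc (Suc i))) / 2 - d (Suc i))) / real m"
    using m by (simp only: sum.distrib sum_constant add_divide_distrib) simp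
  also have "\<dots> \<le> gap \<beta> n v w + - (1 - cos (\<beta> / real n)) * gap \<beta> n v w / real m"
    unfolding gap using cosine_weighted_laplacian[of d m \<beta>] d u m
    by (intro add_left_mono divide_right_mono) (auto simp: u_def)
  also have "\<dots> = (1 - (1 - cos (\<beta> / real n)) / (real n - 1)) * gap \<beta> n v w"
    using m by (simp add: field_simps)
  finally show ?thesis .
qed

text \<open>Heights are integers, so distinct ordered paths differ by at least 1 at some interior
  height, where the weight is at least its end value \<open>cos (\<beta> / 2)\<close>.\<close>

lemma gap_ge_of_neq:
  assumes \<beta>: "0 \<le> \<beta>" "\<beta> \<le> pi" and le: "path_le v w" and len: "length w = n"
    and eq: "ones v n = ones w n" and ne: "v \<noteq> w"
  shows "cos (\<beta> / 2) \<le> gap \<beta> n v w"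
proof -
  have lenv: "length v = n" and ones: "ones v k \<le> ones w k" for k
    using le len by (auto simp: path_le_def)
  obtain k where k: "ones v k \<noteq> ones w k"
    using ones_inject[of v w] lenv len ne by auto
  \<comment> \<open>From \<open>n\<close> on, \<open>take\<close> returns the whole list, so the
    heights there agree by \<open>eq\<close>.\<close>
  have "k < n"
  proof (rule ccontr)
    assume "\<not> k < n"
    then have "ones v k = ones v n" "ones w k = ones w n"
      using len lenv by (simp_all add: ones_def)
    with k eq show False by simp
  qed
  moreover have "k \<noteq> 0" using k by (intro notI) simp
  ultimately obtain i where i: "k = Suc i" "i < n - 1" by (cases k) auto
  have c0: "0 \<le> cos (\<beta> / 2)" using \<beta> by (intro cos_ge_zero) auto
  have c: "cos (\<beta> / 2) \<le> cos (\<beta> * (real (Suc j) / real n - 1 / 2))" if "j < n - 1" for j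
    using that by (intro cos_weight_ge \<beta>) auto
  let ?f = "\<lambda>j. cos (\<beta> * (real (Suc j) / real n - 1 / 2))
              * (real (ones w (Suc j)) - real (ones v (Suc j)))"
  have "cos (\<beta> / 2) * 1 \<le> ?f i"
    using c[OF i(2)] c0 k ones[of k] unfolding i by (intro mult_mono) auto
  also have "\<dots> \<le> (\<Sum>j<n - 1. ?f j)"
    using i c0 ones by (intro member_le_sum mult_nonneg_nonneg order_trans[OF c0 c]) auto
  finally show ?thesis by (simp add: gap_def)
qed

section \<open>Iteration over time: the probability of not having coalesced\<close>

lemma prob_bind_pmf:
  "measure_pmf.prob (bind_pmf p f) A = measure_pmf.expectation p (\<lambda>x. measure_pmf.prob (f x) A)"
  unfolding measure_pmf_bind
  by (rule measure_pmf.measure_bind[where N = "count_space UNIV"])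
     (use measurable_measure_pmf[of f] in simp_all)

lemma prob_replicate_pmf_Suc:
  "measure_pmf.prob (replicate_pmf (Suc t) p) A
     = measure_pmf.expectation p (\<lambda>x. measure_pmf.prob (replicate_pmf t p) {xs. x # xs \<in> A})"
proof -
  have "replicate_pmf (Suc t) p = bind_pmf p (\<lambda>x. map_pmf ((#) x) (replicate_pmf t p))"
    by (simp add: map_pmf_def)
  then have "measure_pmf.prob (replicate_pmf (Suc t) p) A
     = measure_pmf.expectation p (\<lambda>x. measure_pmf.prob (map_pmf ((#) x) (replicate_pmf t p)) A)"
    by (simp only: prob_bind_pmf)
  then show ?thesis by (simp add: vimage_def)
qed

lemma finite_set_random_move: "2 \<le> n \<Longrightarrow> finite (set_pmf (random_move n))"
  by (rule finite_subset[of _ "{..<n} \<times> UNIV"]) (auto dest!: set_random_move)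

lemma finite_set_replicate_pmf:
  "finite (set_pmf p) \<Longrightarrow> finite (set_pmf (replicate_pmf t p))"
  by (induction t) auto

text \<open>The numerator is at most 2, hence at most \<open>real n - 1\<close>. Nonnegativity is
  what allows multiplying inequalities by powers of the factor.\<close>

lemma contraction_factor_nonneg:
  fixes x :: real
  assumes "3 \<le> n"
  shows "0 \<le> 1 - (1 - cos x) / (real n - 1)"
proof -
  have "1 - cos x \<le> 2" using cos_ge_minus_one[of x] by linarith
  also have "2 \<le> real n - 1" using assms by simp
  finally show ?thesis using assms by (simp add: field_simps)
qed

text \<open>Markov's inequality in inductive form: at time 0 the indicator of
  \<open>v \<noteq> w\<close> is at most the gap divided by \<open>cos (\<beta> / 2)\<close>, and
  conditioning on the first move costs one contraction factor. The strict bound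
  \<open>\<beta> < pi\<close> keeps the denominator positive.\<close>

lemma prob_run_moves_neq:
  assumes n: "3 \<le> n" and \<beta>: "0 \<le> \<beta>" "\<beta> < pi"
    and "path_le v w" "length w = n" "ones v n = ones w n"
  shows "measure_pmf.prob (replicate_pmf t (random_move n)) {ms. run_moves ms v \<noteq> run_moves ms w}
    \<le> (1 - (1 - cos (\<beta> / real n)) / (real n - 1)) ^ t * gap \<beta> n v w / cos (\<beta> / 2)"
  using assms(4-6)
proof (induction t arbitrary: v w)
  have c: "0 < cos (\<beta> / 2)" using \<beta> by (intro cos_gt_zero_pi) auto
  {
    case 0
    show ?case
    proof (cases "v = w")
      case True
      then show ?thesis by (simp add: run_moves_def gap_def)
    next
      case False
      with gap_ge_of_neq[of \<beta> v w n] 0 \<beta> have "cos (\<beta> / 2) \<le> gap \<beta> n v w" by simp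
      then have "1 \<le> gap \<beta> n v w / cos (\<beta> / 2)" using c by simp
      then show ?thesis
        by (simp del: replicate_pmf.simps) (rule order_trans[OF measure_pmf.prob_le_1])
    qed
  next
    case (Suc t)
    define \<rho> where "\<rho> = 1 - (1 - cos (\<beta> / real n)) / (real n - 1)"
    have \<rho>: "0 \<le> \<rho>" unfolding \<rho>_def by (rule contraction_factor_nonneg[OF n])
    have int: "integrable (random_move n) f" for f :: "nat \<times> bool \<Rightarrow> real"
      using n by (intro integrable_measure_pmf_finite finite_set_random_move) simp
    \<comment> \<open>Order, length and common final height survive the first move, so the induction
      hypothesis applies to the moved pair.\<close>
    have step: "measure_pmf.prob (replicate_pmf t (random_move n))
          {ms. run_moves ms (apply_move m v) \<noteq> run_moves ms (apply_move m w)}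
        \<le> \<rho> ^ t * gap \<beta> n (apply_move m v) (apply_move m w) / cos (\<beta> / 2)"
      if "m \<in> set_pmf (random_move n)" for m
    proof -
      obtain i c where m: "m = (i, c)" by (cases m)
      have i: "Suc i < n" using set_random_move[OF _ that] n m by simp
      have lenv: "length v = n" using Suc.prems by (simp add: path_le_def)
      show ?thesis
        unfolding m \<rho>_def
      proof (rule Suc.IH)
        show "path_le (apply_move (i, c) v) (apply_move (i, c) w)"
          using Suc.prems i by (intro path_le_apply_move) auto
        show "ones (apply_move (i, c) v) n = ones (apply_move (i, c) w) n"
          using Suc.prems i lenv by (simp add: ones_apply_move_other del: apply_move.simps)
      qed (use Suc.prems in \<open>simp del: apply_move.simps\<close>)
    qed
    have "measure_pmf.prob (replicate_pmf (Suc t) (random_move n)) {ms. run_moves ms v \<noteq> run_moves ms w}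
      = measure_pmf.expectation (random_move n) (\<lambda>m. measure_pmf.prob (replicate_pmf t (random_move n))
          {ms. run_moves ms (apply_move m v) \<noteq> run_moves ms (apply_move m w)})"
      by (simp add: prob_replicate_pmf_Suc run_moves_Cons del: replicate_pmf.simps)
    also have "\<dots> \<le> measure_pmf.expectation (random_move n)
        (\<lambda>m. \<rho> ^ t / cos (\<beta> / 2) * gap \<beta> n (apply_move m v) (apply_move m w))"
      using step by (intro integral_mono_AE int) (simp add: AE_measure_pmf_iff)
    also have "\<dots> = \<rho> ^ t / cos (\<beta> / 2) * measure_pmf.expectation (random_move n)
        (\<lambda>m. gap \<beta> n (apply_move m v) (apply_move m w))"
      by simp
    also have "\<dots> \<le> \<rho> ^ t / cos (\<beta> / 2) * (\<rho> * gap \<beta> n v w)"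
      unfolding \<rho>_def using n \<beta> Suc.prems c \<rho>[unfolded \<rho>_def]
      by (intro mult_left_mono expectation_gap_random_move) auto
    finally show ?case by (simp add: \<rho>_def mult_ac)
  }
qed

text \<open>All weights are at most 1, so the gap is at most the area between the two paths.\<close>

lemma gap_extremal_le:
  assumes "0 \<le> \<beta>" "\<beta> \<le> pi" "1 \<le> a + b"
  shows "gap \<beta> (a + b) (bottom_path a b) (top_path a b) \<le> real (a * b)"
proof -
  let ?d = "\<lambda>k. real (ones (top_path a b) k) - real (ones (bottom_path a b) k)"
  have d: "0 \<le> ?d k" for k
    using path_le_extremal(2)[OF extremal_lattice_paths(1)] by (simp add: path_le_def)
  have "gap \<beta> (a + b) (bottom_path a b) (top_path a b) \<le> (\<Sum>i<a + b - 1. 1 * ?d (Suc i))"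
    unfolding gap_def by (intro sum_mono mult_right_mono d) simp
  also have "\<dots> = (\<Sum>k\<in>Suc ` {..<a + b - 1}. ?d k)"
    by (simp add: sum.reindex)
  also have "\<dots> \<le> (\<Sum>k\<le>a + b. ?d k)"
    by (intro sum_mono2 d) auto
  also have "\<dots> = real (\<Sum>k\<le>a + b. ones (top_path a b) k) - real (\<Sum>k\<le>a + b. ones (bottom_path a b) k)"
    by (simp add: sum_subtractf)
  also have "\<dots> = real (a * b)"
    unfolding sum_ones_extremal by simp
  finally show ?thesis .
qed

lemma coalescence_prob_eq:
  "1 - coalescence_prob a b t = measure_pmf.prob (replicate_pmf t (random_move (a + b)))
     {ms. run_moves ms (bottom_path a b) \<noteq> run_moves ms (top_path a b)}"
proof -
  have "{ms. run_moves ms (bottom_path a b) \<noteq> run_moves ms (top_path a b)} =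
        UNIV - {ms. run_moves ms (top_path a b) = run_moves ms (bottom_path a b)}"
    by auto
  then show ?thesis
    unfolding coalescence_prob_def by (simp add: measure_pmf.prob_compl[simplified])
qed

lemma coalescence_prob_lower_bound:
  assumes "3 \<le> a + b" "0 \<le> \<beta>" "\<beta> < pi"
  shows "1 - coalescence_prob a b t
    \<le> (1 - (1 - cos (\<beta> / real (a + b))) / (real (a + b) - 1)) ^ t * real (a * b) / cos (\<beta> / 2)"
proof -
  have c: "0 < cos (\<beta> / 2)" using assms by (intro cos_gt_zero_pi) auto
  have "1 - coalescence_prob a b t
    \<le> (1 - (1 - cos (\<beta> / real (a + b))) / (real (a + b) - 1)) ^ t
       * gap \<beta> (a + b) (bottom_path a b) (top_path a b) / cos (\<beta> / 2)"
    unfolding coalescence_prob_eq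
    using assms path_le_extremal(2)[OF extremal_lattice_paths(1)]
      ones_lattice_path[OF extremal_lattice_paths(1)] ones_lattice_path[OF extremal_lattice_paths(2)]
    by (intro prob_run_moves_neq) (auto simp: top_path_def)
  also have "\<dots> \<le> (1 - (1 - cos (\<beta> / real (a + b))) / (real (a + b) - 1)) ^ t * real (a * b) / cos (\<beta> / 2)"
    using assms c by (intro divide_right_mono mult_left_mono gap_extremal_le zero_le_power
        contraction_factor_nonneg) auto
  finally show ?thesis .
qed

section \<open>From coalescence to variation distance: coupling and stationarity\<close>

lemma tv_dist_le_coupling:
  assumes "finite (set_pmf M)"
  shows "tv_dist (map_pmf fst M) (map_pmf snd M) \<le> measure_pmf.prob M {z. fst z \<noteq> snd z}"
proof -
  define S where "S = fst ` set_pmf M \<union> snd ` set_pmf M"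
  have S: "finite S" using assms by (simp add: S_def)
  let ?P = "measure_pmf.prob M"
  have sum_le: "(\<Sum>x\<in>S. ?P {z. f z = x \<and> fst z \<noteq> snd z}) \<le> ?P {z. fst z \<noteq> snd z}"
    for f :: "'a \<times> 'a \<Rightarrow> 'a"
  proof -
    have "(\<Sum>x\<in>S. ?P {z. f z = x \<and> fst z \<noteq> snd z}) = ?P (\<Union>x\<in>S. {z. f z = x \<and> fst z \<noteq> snd z})"
      using S by (intro measure_pmf.finite_measure_finite_Union[symmetric])
        (auto simp: disjoint_family_on_def)
    also have "\<dots> \<le> ?P {z. fst z \<noteq> snd z}"
      by (intro measure_pmf.finite_measure_mono) auto
    finally show ?thesis .
  qed
  \<comment> \<open>The mass at \<open>x\<close> on which both coordinates agree cancels; only the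
    mismatched parts remain.\<close>
  have diff: "\<bar>pmf (map_pmf fst M) x - pmf (map_pmf snd M) x\<bar>
      \<le> ?P {z. fst z = x \<and> fst z \<noteq> snd z} + ?P {z. snd z = x \<and> fst z \<noteq> snd z}" for x
  proof -
    have "pmf (map_pmf f M) x = ?P {z. f z = x}" for f
      by (simp add: pmf_map vimage_def)
    moreover have "?P {z. f z = x} = ?P {z. f z = x \<and> fst z \<noteq> snd z} + ?P {z. f z = x \<and> fst z = snd z}" for f
      by (subst measure_pmf.finite_measure_Union[symmetric]) (auto intro!: arg_cong[where f = ?P])
    moreover have "{z. fst z = x \<and> fst z = snd z} = {z. snd z = x \<and> fst z = snd z}"
      by auto
    moreover have "0 \<le> ?P A" for A
      by simp
    ultimately show ?thesis
      by (auto simp: abs_le_iff)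
  qed
  have "pmf (map_pmf fst M) x = 0" "pmf (map_pmf snd M) x = 0" if "x \<notin> S" for x
    using that by (auto simp: S_def pmf_eq_0_set_pmf)
  then have "(\<Sum>\<^sub>\<infinity>x. \<bar>pmf (map_pmf fst M) x - pmf (map_pmf snd M) x\<bar>)
      = (\<Sum>\<^sub>\<infinity>x\<in>S. \<bar>pmf (map_pmf fst M) x - pmf (map_pmf snd M) x\<bar>)"
    by (intro infsum_cong_neutral) auto
  also have "\<dots> = (\<Sum>x\<in>S. \<bar>pmf (map_pmf fst M) x - pmf (map_pmf snd M) x\<bar>)"
    using S by simp
  also have "\<dots> \<le> (\<Sum>x\<in>S. ?P {z. fst z = x \<and> fst z \<noteq> snd z} + ?P {z. snd z = x \<and> fst z \<noteq> snd z})"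
    by (intro sum_mono diff)
  \<comment> \<open>Each coordinate contributes the mismatch probability once; the factor 2 is
    absorbed by the \<open>1 / 2\<close> in \<open>tv_dist\<close>.\<close>
  also have "\<dots> \<le> 2 * ?P {z. fst z \<noteq> snd z}"
    using sum_le[of fst] sum_le[of snd] by (simp add: sum.distrib)
  finally show ?thesis by (simp add: tv_dist_def)
qed

text \<open>\<open>path_law\<close> adds a step at the end, while a list of moves is consumed from
  its head; this reconciles the two recursions.\<close>

lemma path_law_Suc_left: "path_law n w (Suc t) = bind_pmf (path_kernel n w) (\<lambda>v. path_law n v t)"
  by (induction t) (simp_all add: bind_return_pmf bind_return_pmf' bind_assoc_pmf)

lemma path_law_eq_run_moves:
  "path_law n w t = map_pmf (\<lambda>ms. run_moves ms w) (replicate_pmf t (random_move n))"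
proof (induction t arbitrary: w)
  case (Suc t)
  show ?case
    unfolding path_law_Suc_left Suc.IH
    by (simp add: path_kernel_def bind_map_pmf map_bind_pmf run_moves_Cons map_pmf_def
        bind_assoc_pmf bind_return_pmf)
qed (simp add: run_moves_def)

lemma map_pmf_Not_bernoulli_half: "map_pmf Not (bernoulli_pmf (1 / 2)) = bernoulli_pmf (1 / 2)"
proof -
  have "bij Not" by (rule involuntory_imp_bij) simp
  then show ?thesis
    by (simp add: bernoulli_pmf_half_conv_pmf_of_set map_pmf_of_set_bij_betw)
qed

text \<open>The coin can be reread as stay or swap: on a descending pair its roles are exchanged,
  which a fair coin does not notice.\<close>

lemma map_apply_move_coin:
  assumes "Suc i < length w"
  shows "map_pmf (\<lambda>c. apply_move (i, c) w) (bernoulli_pmf (1 / 2)) =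
         map_pmf (\<lambda>c. if c then w else transpose_at i w) (bernoulli_pmf (1 / 2))"
proof (cases "w ! i \<le> w ! Suc i")
  case True
  then show ?thesis using assms by (simp add: apply_move_eq del: apply_move.simps)
next
  case False
  have "map_pmf (\<lambda>c. if c then w else transpose_at i w) (bernoulli_pmf (1 / 2))
      = map_pmf (\<lambda>c. if c then w else transpose_at i w) (map_pmf Not (bernoulli_pmf (1 / 2)))"
    by (simp only: map_pmf_Not_bernoulli_half)
  also have "\<dots> = map_pmf (\<lambda>c. if c then transpose_at i w else w) (bernoulli_pmf (1 / 2))"
    by (simp add: map_pmf_comp if_distrib cong: if_cong) (intro map_pmf_cong; simp)
  also have "\<dots> = map_pmf (\<lambda>c. apply_move (i, c) w) (bernoulli_pmf (1 / 2))"
    using assms False by (intro map_pmf_cong) (auto simp: apply_move_eq simp del: apply_move.simps)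
  finally show ?thesis ..
qed

lemma lattice_paths_nonempty: "lattice_paths a b \<noteq> {}"
  using extremal_lattice_paths(1) by blast

text \<open>Sorting is not injective, so the coin is first reread as stay or swap. For each fixed
  position and outcome the update is then a bijection of the paths, and mixtures of maps preserving
  \<open>U\<close> preserve \<open>U\<close>.\<close>

lemma bind_uniform_path_kernel:
  assumes "2 \<le> a + b"
  defines "U \<equiv> pmf_of_set (lattice_paths a b)"
  shows "bind_pmf U (path_kernel (a + b)) = U"
proof -
  let ?B = "bernoulli_pmf (1 / 2)"
  let ?I = "pmf_of_set {..<a + b - 1}"
  have setU: "set_pmf U = lattice_paths a b"
    unfolding U_def using finite_lattice_paths lattice_paths_nonempty by (rule set_pmf_of_set[rotated])
  have I: "i \<in> set_pmf ?I \<Longrightarrow> Suc i < a + b" for i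
    using assms(1) by (subst (asm) set_pmf_of_set) (auto simp: lessThan_empty_iff)
  have inner: "bind_pmf U (\<lambda>w. map_pmf (\<lambda>c. apply_move (i, c) w) ?B) = U" if i: "Suc i < a + b" for i
  proof -
    have "bind_pmf U (\<lambda>w. map_pmf (\<lambda>c. apply_move (i, c) w) ?B)
        = bind_pmf U (\<lambda>w. map_pmf (\<lambda>c. if c then w else transpose_at i w) ?B)"
      using i by (intro bind_pmf_cong refl map_apply_move_coin) (auto simp: setU lattice_paths_def)
    also have "\<dots> = bind_pmf ?B (\<lambda>c. map_pmf (\<lambda>w. if c then w else transpose_at i w) U)"
      unfolding map_pmf_def by (rule bind_commute_pmf)
    also have "\<dots> = bind_pmf ?B (\<lambda>c. U)"
    proof (intro bind_pmf_cong refl)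
      fix c
      have "map_pmf (transpose_at i) U = U"
        unfolding U_def
        using transpose_at_lattice_paths[OF i] lattice_paths_nonempty finite_lattice_paths
        by (rule map_pmf_of_set_bij_betw)
      then show "map_pmf (\<lambda>w. if c then w else transpose_at i w) U = U"
        by (cases c) simp_all
    qed
    finally show ?thesis by simp
  qed
  have "bind_pmf U (path_kernel (a + b))
      = bind_pmf U (\<lambda>w. bind_pmf ?I (\<lambda>i. map_pmf (\<lambda>c. apply_move (i, c) w) ?B))"
    by (simp add: path_kernel_def[abs_def] random_move_def pair_pmf_def map_bind_pmf map_pmf_def
        bind_assoc_pmf bind_return_pmf del: apply_move.simps)
  also have "\<dots> = bind_pmf ?I (\<lambda>i. bind_pmf U (\<lambda>w. map_pmf (\<lambda>c. apply_move (i, c) w) ?B))"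
    by (rule bind_commute_pmf)
  also have "\<dots> = bind_pmf ?I (\<lambda>i. U)"
    using I by (intro bind_pmf_cong refl inner)
  finally show ?thesis by simp
qed

lemma bind_uniform_path_law:
  assumes "2 \<le> a + b"
  shows "bind_pmf (pmf_of_set (lattice_paths a b)) (\<lambda>w. path_law (a + b) w t)
           = pmf_of_set (lattice_paths a b)"
proof (induction t)
  case (Suc t)
  then show ?case
    using bind_uniform_path_kernel[OF assms] by (simp add: bind_assoc_pmf[symmetric])
qed (simp add: bind_return_pmf')

text \<open>The same moves drive the copy from \<open>w\<close> and a copy from an independent
  uniform start, which stays uniform. By monotonicity both lie between the extremal copies, so they
  can differ only if those do.\<close>

lemma tv_dist_path_law_le:
  assumes n: "2 \<le> a + b" and w: "w \<in> lattice_paths a b"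
  shows "tv_dist (path_law (a + b) w t) (pmf_of_set (lattice_paths a b)) \<le> 1 - coalescence_prob a b t"
proof -
  define R where "R = replicate_pmf t (random_move (a + b))"
  define U where "U = pmf_of_set (lattice_paths a b)"
  define M where "M = map_pmf (\<lambda>(ms, v). (run_moves ms w, run_moves ms v)) (pair_pmf R U)"
  let ?top = "top_path a b" and ?bot = "bottom_path a b"
  have finR: "finite (set_pmf R)"
    unfolding R_def by (intro finite_set_replicate_pmf finite_set_random_move n)
  have setU: "set_pmf U = lattice_paths a b"
    unfolding U_def using finite_lattice_paths lattice_paths_nonempty by (rule set_pmf_of_set[rotated])
  have finM: "finite (set_pmf M)"
    using finR finite_lattice_paths by (simp add: M_def setU)
  have fst: "map_pmf fst M = path_law (a + b) w t"
  proof -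
    have "map_pmf fst M = map_pmf (\<lambda>ms. run_moves ms w) (map_pmf fst (pair_pmf R U))"
      by (simp add: M_def map_pmf_comp case_prod_unfold)
    then show ?thesis by (simp add: map_fst_pair_pmf path_law_eq_run_moves R_def)
  qed
  \<comment> \<open>Exchanging the order of sampling puts the uniform start first, so that
    stationarity applies.\<close>
  have snd: "map_pmf snd M = U"
  proof -
    have "map_pmf snd M = bind_pmf R (\<lambda>ms. bind_pmf U (\<lambda>v. return_pmf (run_moves ms v)))"
      by (simp add: M_def map_pmf_comp case_prod_unfold pair_pmf_def map_bind_pmf)
    also have "\<dots> = bind_pmf U (\<lambda>v. bind_pmf R (\<lambda>ms. return_pmf (run_moves ms v)))"
      by (rule bind_commute_pmf)
    also have "\<dots> = bind_pmf U (\<lambda>v. path_law (a + b) v t)"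
      by (simp add: path_law_eq_run_moves R_def map_pmf_def)
    also have "\<dots> = U"
      unfolding U_def by (rule bind_uniform_path_law[OF n])
    finally show ?thesis .
  qed
  have moves: "Suc (fst m) < a + b" if "ms \<in> set_pmf R" "m \<in> set ms" for ms m
    using that set_random_move[OF n, of m] by (auto simp: R_def set_replicate_pmf)
  have sandwich: "run_moves ms w = run_moves ms v"
    if ms: "ms \<in> set_pmf R" and v: "v \<in> lattice_paths a b"
      and eq: "run_moves ms ?bot = run_moves ms ?top" for ms v
  proof -
    have "path_le (run_moves ms x) (run_moves ms ?top)" "path_le (run_moves ms ?bot) (run_moves ms x)"
      if x: "x \<in> lattice_paths a b" for x
    proof -
      have "length x = a + b" "length ?top = a + b"
        using x by (auto simp: lattice_paths_def top_path_def)
      then show "path_le (run_moves ms x) (run_moves ms ?top)"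
           "path_le (run_moves ms ?bot) (run_moves ms x)"
        using path_le_extremal[OF x] moves[OF ms] by (metis path_le_run_moves)+
    qed
    then have "run_moves ms x = run_moves ms ?top" if "x \<in> lattice_paths a b" for x
      using that eq by (metis path_le_antisym)
    then show ?thesis using w v by simp
  qed
  have "tv_dist (map_pmf fst M) (map_pmf snd M) \<le> measure_pmf.prob M {z. fst z \<noteq> snd z}"
    by (rule tv_dist_le_coupling[OF finM])
  also have "\<dots> = measure_pmf.prob (pair_pmf R U) {(ms, v). run_moves ms w \<noteq> run_moves ms v}"
    by (simp add: M_def vimage_def case_prod_unfold)
  also have "\<dots> \<le> measure_pmf.prob (pair_pmf R U) {(ms, v). run_moves ms ?bot \<noteq> run_moves ms ?top}"
    using sandwich by (intro measure_pmf.finite_measure_mono_AE) (auto simp: AE_measure_pmf_iff setU)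
  also have "\<dots> = measure_pmf.prob (map_pmf fst (pair_pmf R U)) {ms. run_moves ms ?bot \<noteq> run_moves ms ?top}"
    by (simp add: vimage_def case_prod_unfold)
  also have "\<dots> = 1 - coalescence_prob a b t"
    by (simp add: map_fst_pair_pmf R_def coalescence_prob_eq)
  finally show ?thesis by (simp add: fst snd U_def)
qed

section \<open>Choice of the angle and the asymptotic threshold\<close>

definition weight_angle :: "nat \<Rightarrow> real" where
  "weight_angle n = pi - 1 / ln (real n)"

text \<open>This solves \<open>(2 + excess n) / pi ^ 2 * real n ^ 3 * r = 1 + c / ln (real n -
  1)\<close>, where \<open>r\<close> is the contraction rate
  \<open>(1 - cos (\<beta> / real n)) / (real n - 1)\<close>, \<open>c\<close> is
  \<open>- ln (cos (\<beta> / 2))\<close> and \<open>\<beta>\<close> is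
  \<open>weight_angle n\<close>.\<close>

definition excess :: "nat \<Rightarrow> real" where
  "excess n = pi ^ 2 * (real n - 1) / (real n ^ 3 * (1 - cos (weight_angle n / real n)))
     * (1 - ln (cos (weight_angle n / 2)) / ln (real n - 1)) - 2"

text \<open>The first factor tends to 2, because \<open>1 - cos x\<close> behaves like half of
  \<open>x\<close> squared near 0 and the angle tends to \<open>pi\<close>. The correction factor
  tends to 1.\<close>

lemma excess_tendsto_0: "excess \<longlonglongrightarrow> 0"
proof -
  \<comment> \<open>Rewriting as a sine of a small argument exposes the logarithmic singularity to
    the asymptotic expansion.\<close>
  have c: "cos (weight_angle n / 2) = sin (1 / (2 * ln (real n)))" for n
    by (simp add: weight_angle_def diff_divide_distrib cos_diff mult.commute)
  show ?thesis
    unfolding excess_def[abs_def] c unfolding weight_angle_def power2_eq_square by real_asymp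
qed

lemma coalescence_prob_threshold:
  assumes ab: "1 \<le> a" "1 \<le> b" and n: "a + b = n" "3 \<le> n" and \<epsilon>: "0 < \<epsilon>" "\<epsilon> < 1"
    and t: "real t \<ge> (2 + excess n) / pi ^ 2 * real n ^ 3 * ln (real a * real b / \<epsilon>)"
  shows "1 - coalescence_prob a b t \<le> \<epsilon>"
proof -
  define \<beta> where "\<beta> = weight_angle n"
  define r where "r = (1 - cos (\<beta> / real n)) / (real n - 1)"
  define c where "c = - ln (cos (\<beta> / 2))"
  define L where "L = ln (real a * real b / \<epsilon>)"
  \<comment> \<open>This places the angle strictly between 0 and \<open>pi\<close>.\<close>
  have "1 < ln (real n)"
  proof -
    have "exp 1 < real n" using exp_le n e_less_272 by linarith
    then have "ln (exp 1) < ln (real n)" using n by (subst ln_less_cancel_iff) auto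
    then show ?thesis by simp
  qed
  then have "0 < 1 / ln (real n)" "1 / ln (real n) < 1" by (auto simp: field_simps)
  then have \<beta>: "0 < \<beta>" "\<beta> < pi" using pi_gt3 unfolding \<beta>_def weight_angle_def by linarith+
  have cos: "0 < cos (\<beta> / 2)" using \<beta> by (intro cos_gt_zero_pi) auto
  have c: "0 \<le> c" unfolding c_def using cos by (simp add: ln_le_zero_iff)
  have "\<beta> / real n \<le> \<beta> / 1" using \<beta> n by (intro divide_left_mono) auto
  then have "cos (\<beta> / real n) < cos 0"
    using \<beta> n by (intro cos_monotone_0_pi) auto
  then have r: "0 < r" using n by (simp add: r_def)
  \<comment> \<open>With \<open>a + b = n\<close> fixed, the product is smallest when one side is 1.
    Hence \<open>L\<close> is at least \<open>ln (real n - 1)\<close>, and the additive cost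
    \<open>c\<close> is at most a proportion of \<open>L\<close> depending on \<open>n\<close>
    alone.\<close>
  have "real n - 1 \<le> real a * real b"
  proof -
    have "0 \<le> (real a - 1) * (real b - 1)" using ab by (intro mult_nonneg_nonneg) auto
    then show ?thesis using n by (simp add: algebra_simps)
  qed
  also have "\<dots> \<le> real a * real b / \<epsilon>"
    using \<epsilon> by (simp add: pos_le_divide_eq mult_left_le)
  finally have "ln (real n - 1) \<le> L"
    unfolding L_def using n by (intro ln_mono) auto
  moreover have l: "0 < ln (real n - 1)" using n by simp
  ultimately have "c \<le> c / ln (real n - 1) * L"
    using c by (simp add: pos_le_divide_eq mult_left_mono)
  then have "L + c \<le> (1 + c / ln (real n - 1)) * L" by (simp add: algebra_simps)
  also have "\<dots> = (2 + excess n) / pi ^ 2 * real n ^ 3 * L * r"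
  proof -
    have "2 + excess n = pi ^ 2 / (real n ^ 3 * r) * (1 + c / ln (real n - 1))"
      by (simp add: excess_def \<beta>_def r_def c_def)
    moreover have "pi ^ 2 \<noteq> 0" "real n ^ 3 \<noteq> 0" "r \<noteq> 0"
      using n r by auto
    ultimately show ?thesis by simp
  qed
  also have "\<dots> \<le> real t * r"
    using t r unfolding L_def by (intro mult_right_mono) auto
  finally have "exp (- (real t * r)) \<le> exp (- (L + c))" by simp
  also have "\<dots> = \<epsilon> / (real a * real b) * cos (\<beta> / 2)"
  proof -
    have "exp L = real a * real b / \<epsilon>"
      unfolding L_def using ab \<epsilon> by (intro exp_ln) auto
    moreover have "exp (- c) = cos (\<beta> / 2)"
      unfolding c_def using cos by simp
    moreover have "exp (- (L + c)) = exp (- c) / exp L"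
      by (simp add: exp_diff[symmetric])
    ultimately show ?thesis by simp
  qed
  finally have E: "exp (- (real t * r)) \<le> \<epsilon> / (real a * real b) * cos (\<beta> / 2)" .
  \<comment> \<open>Nonnegativity lets \<open>1 - r \<le> exp (- r)\<close> be raised to the power
    \<open>t\<close>.\<close>
  have "0 \<le> 1 - r" unfolding r_def by (rule contraction_factor_nonneg[OF n(2)])
  then have pow: "(1 - r) ^ t \<le> exp (- r) ^ t"
    using exp_ge_add_one_self[of "- r"] by (intro power_mono) auto
  have "1 - coalescence_prob a b t \<le> (1 - r) ^ t * real (a * b) / cos (\<beta> / 2)"
    unfolding r_def using coalescence_prob_lower_bound[of a b \<beta> t] n \<beta> by simp
  also have "\<dots> \<le> (\<epsilon> / (real a * real b) * cos (\<beta> / 2)) * real (a * b) / cos (\<beta> / 2)"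
  proof (intro divide_right_mono mult_right_mono)
    have "exp (- r) ^ t = exp (- (real t * r))"
      by (simp add: exp_of_nat_mult[symmetric])
    then show "(1 - r) ^ t \<le> \<epsilon> / (real a * real b) * cos (\<beta> / 2)"
      using E pow by linarith
  qed (use cos in auto)
  also have "\<dots> = \<epsilon>"
    using ab cos by simp
  finally show ?thesis .
qed

theorem theorem2:
  "\<exists>\<delta> :: nat \<Rightarrow> real. \<delta> \<longlonglongrightarrow> 0 \<and>
     (\<exists>N :: nat. \<forall>n \<ge> N. \<forall>(a :: nat) (b :: nat) (\<epsilon> :: real) (t :: nat).
        1 \<le> a \<longrightarrow> 1 \<le> b \<longrightarrow> a + b = n \<longrightarrow> 0 < \<epsilon> \<longrightarrow> \<epsilon> < 1 \<longrightarrow>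
        real t \<ge> (2 + \<delta> n) / pi ^ 2 * real n ^ 3 * ln (real a * real b / \<epsilon>) \<longrightarrow>
          (\<forall>w \<in> lattice_paths a b.
             tv_dist (path_law n w t) (pmf_of_set (lattice_paths a b)) \<le> \<epsilon>) \<and>
          coalescence_prob a b t \<ge> 1 - \<epsilon>)"
proof (intro exI conjI)
  show "excess \<longlonglongrightarrow> 0" by (rule excess_tendsto_0)
  show "\<forall>n \<ge> 3. \<forall>(a :: nat) (b :: nat) (\<epsilon> :: real) (t :: nat).
        1 \<le> a \<longrightarrow> 1 \<le> b \<longrightarrow> a + b = n \<longrightarrow> 0 < \<epsilon> \<longrightarrow> \<epsilon> < 1 \<longrightarrow>
        real t \<ge> (2 + excess n) / pi ^ 2 * real n ^ 3 * ln (real a * real b / \<epsilon>) \<longrightarrow>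
          (\<forall>w \<in> lattice_paths a b.
             tv_dist (path_law n w t) (pmf_of_set (lattice_paths a b)) \<le> \<epsilon>) \<and>
          coalescence_prob a b t \<ge> 1 - \<epsilon>"
  proof (intro allI impI)
    fix n a b :: nat and \<epsilon> :: real and t :: nat
    assume *: "3 \<le> n" "1 \<le> a" "1 \<le> b" "a + b = n" "0 < \<epsilon>" "\<epsilon> < 1"
      "real t \<ge> (2 + excess n) / pi ^ 2 * real n ^ 3 * ln (real a * real b / \<epsilon>)"
    then have "1 - coalescence_prob a b t \<le> \<epsilon>" by (intro coalescence_prob_threshold[of a b n])
    then show "(\<forall>w \<in> lattice_paths a b.
             tv_dist (path_law n w t) (pmf_of_set (lattice_paths a b)) \<le> \<epsilon>) \<and>
          coalescence_prob a b t \<ge> 1 - \<epsilon>"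
      using tv_dist_path_law_le[of a b _ t] * by force
  qed
qed

end
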